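(* Let $n,k$ be integers with $n\ge k\ge 3$. There exists a shiftable Heffter array $H_s(n;k)$ if and only if $k$ is even and $nk\equiv 0\pmod 4$.
   Context: For positive integers $n,k$, a (square integer) Heffter array $H(n;k)$ is an $n\times n$ array of integers, possibly with empty cells, such that: (1) each row and each column contains exactly $k$ filled cells; (2) the entries in every row and in every column sum to $0$ in $\mathbb{Z}$; (3) for every $x\in\{1,2,\ldots,nk\}$ either $x$ or $-x$ appears in the array (so, as there are exactly $nk$ filled cells, exactly one of $x,-x$ appears, exactly once). An array of integers, possibly with empty cells, is shiftable if each row and each column contains the same number of positive and negative entries. $H_s(n;k)$ denotes a shiftable $H(n;k)$. *)

theory Defs
  imports "HOL-Number_Theory.Cong"
begin

text \<open>
  Rows and columns are indexed from 0.  An \<open>m \<times> n\<close> array is given by the values \<open>A i j\<close> with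
  \<open>i < m\<close> and \<open>j < n\<close>; \<open>None\<close> is an empty cell, and values outside this range are never inspected.
\<close>
type_synonym int_array = "nat \<Rightarrow> nat \<Rightarrow> int option"

definition row_cells :: "nat \<Rightarrow> int_array \<Rightarrow> nat \<Rightarrow> nat set" where
  "row_cells n A i = {j. j < n \<and> A i j \<noteq> None}"

definition col_cells :: "nat \<Rightarrow> int_array \<Rightarrow> nat \<Rightarrow> nat set" where
  "col_cells m A j = {i. i < m \<and> A i j \<noteq> None}"

definition heffter_array :: "nat \<Rightarrow> nat \<Rightarrow> int_array \<Rightarrow> bool" where
  "heffter_array n k A \<longleftrightarrow>
     (\<forall>i<n. card (row_cells n A i) = k) \<and>
     (\<forall>j<n. card (col_cells n A j) = k) \<and>
     (\<forall>i<n. (\<Sum>j\<in>row_cells n A i. the (A i j)) = 0) \<and>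
     (\<forall>j<n. (\<Sum>i\<in>col_cells n A j. the (A i j)) = 0) \<and>
     (\<forall>x\<in>{1..int (n * k)}. \<exists>i<n. \<exists>j<n. A i j = Some x \<or> A i j = Some (- x))"

definition shiftable :: "nat \<Rightarrow> nat \<Rightarrow> int_array \<Rightarrow> bool" where
  "shiftable m n A \<longleftrightarrow>
     (\<forall>i<m. card {j \<in> row_cells n A i. the (A i j) > 0} = card {j \<in> row_cells n A i. the (A i j) < 0}) \<and>
     (\<forall>j<n. card {i \<in> col_cells m A j. the (A i j) > 0} = card {i \<in> col_cells m A j. the (A i j) < 0})"

definition shiftable_heffter_array :: "nat \<Rightarrow> nat \<Rightarrow> int_array \<Rightarrow> bool" where
  "shiftable_heffter_array n k A \<longleftrightarrow> heffter_array n k A \<and> shiftable n n A"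

end

theory Submission
  imports Defs
begin

text \<open>
  Necessity: the \<open>n k\<close> filled cells have to realise \<open>1, \<dots>, n k\<close> as absolute values, so no entry
  is zero and \<open>k\<close> is even; as the entries add up to \<open>0\<close>, the sum \<open>n k (n k + 1) / 2\<close> of the absolute
  values is even.

  Sufficiency: the array is a union of \<open>k\<close> permutation matrices carrying signs
  \<open>+ - - + + - - + \<dots>\<close>, so that it is shiftable and only the pair sums matter.  If \<open>k\<close> is
  divisible by \<open>4\<close>, cyclic diagonals filled with consecutive integers work, where the two diagonals
  of a pair start in the same row.  Otherwise \<open>n\<close> is even and the array is a circulant array of
  \<open>2 \<times> 2\<close> blocks, \<open>k / 2\<close> of them per block row.  Their \<open>2 k\<close> absolute values are consecutive; four by
  four they fill the blocks, except that the first three blocks are filled by the partition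
  \<open>1 + 5 = 6\<close>, \<open>2 + 8 = 10\<close>, \<open>4 + 7 = 11\<close>, \<open>3 + 9 = 12\<close> of \<open>1, \<dots>, 12\<close> into Schur triples.
\<close>

section \<open>Necessary conditions from counting and parity of the entries\<close>

text \<open>Only \<open>n * k\<close> cells are available to cover \<open>n * k\<close> absolute
  values, so counting excludes both repetitions and values outside the range.\<close>

lemma heffter_entries:
  assumes "heffter_array n k A"
  defines "C \<equiv> Sigma {..<n} (row_cells n A)"
  shows "inj_on (\<lambda>(i, j). \<bar>the (A i j)\<bar>) C"
    and "(\<lambda>(i, j). \<bar>the (A i j)\<bar>) ` C = {1..int (n * k)}"
proof -
  let ?f = "\<lambda>(i, j). \<bar>the (A i j)\<bar>"
  have fin: "finite C"
    by (auto simp: C_def row_cells_def)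
  have "card C = (\<Sum>i<n. card (row_cells n A i))"
    unfolding C_def by (rule card_SigmaI) (auto simp: row_cells_def)
  also have "\<dots> = n * k"
    using assms(1) by (simp add: heffter_array_def)
  finally have card: "card C = n * k" .
  have sub: "{1..int (n * k)} \<subseteq> ?f ` C"
  proof
    fix x assume x: "x \<in> {1..int (n * k)}"
    then obtain i j where "i < n" "j < n" "A i j = Some x \<or> A i j = Some (- x)"
      using assms(1) unfolding heffter_array_def by blast
    then show "x \<in> ?f ` C"
      using x by (intro image_eqI[of _ _ "(i, j)"]) (auto simp: C_def row_cells_def)
  qed
  have le: "card (?f ` C) \<le> card {1..int (n * k)}"
    using card_image_le[OF fin, of ?f] unfolding card by (simp only: card_atLeastAtMost_int)
  show im: "?f ` C = {1..int (n * k)}"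
    using card_seteq[OF _ sub le] fin by simp
  show "inj_on ?f C"
    by (rule eq_card_imp_inj_on[OF fin]) (simp only: im card card_atLeastAtMost_int)
qed

lemma shiftable_heffter_even:
  assumes "shiftable_heffter_array n k A" "n > 0"
  shows "even k"
proof -
  have H: "heffter_array n k A" and S: "shiftable n n A"
    using assms(1) by (auto simp: shiftable_heffter_array_def)
  let ?R = "row_cells n A 0"
  have fin: "finite ?R"
    by (simp add: row_cells_def)
  have nz: "the (A 0 j) \<noteq> 0" if "j \<in> ?R" for j
  proof -
    have "\<bar>the (A 0 j)\<bar> \<in> {1..int (n * k)}"
      unfolding heffter_entries(2)[OF H, symmetric]
      by (rule image_eqI[of _ _ "(0, j)"]) (use that assms(2) in auto)
    then show ?thesis
      by auto
  qed
  have split: "?R = {j \<in> ?R. the (A 0 j) > 0} \<union> {j \<in> ?R. the (A 0 j) < 0}"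
    using nz by (auto simp: neq_iff)
  have "k = card ?R"
    using H assms(2) by (simp add: heffter_array_def)
  also have "\<dots> = card {j \<in> ?R. the (A 0 j) > 0} + card {j \<in> ?R. the (A 0 j) < 0}"
    by (subst split, rule card_Un_disjoint) (use fin in auto)
  also have "\<dots> = 2 * card {j \<in> ?R. the (A 0 j) > 0}"
    using S assms(2) by (simp add: shiftable_def)
  finally show ?thesis
    by simp
qed

lemma heffter_even_sum:
  assumes "heffter_array n k A"
  shows "4 dvd n * k * (n * k + 1)"
proof -
  define C where "C = Sigma {..<n} (row_cells n A)"
  let ?f = "\<lambda>(i, j). \<bar>the (A i j)\<bar>"
  have fin: "finite C"
    by (auto simp: C_def row_cells_def)
  have "(\<Sum>(i, j)\<in>C. the (A i j)) = (\<Sum>i<n. \<Sum>j\<in>row_cells n A i. the (A i j))"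
    unfolding C_def by (subst sum.Sigma) (auto simp: row_cells_def)
  also have "\<dots> = 0"
    using assms by (simp add: heffter_array_def)
  finally have zero: "(\<Sum>(i, j)\<in>C. the (A i j)) = 0" .
  \<comment> \<open>An integer and its absolute value have the same parity.\<close>
  have "even (\<Sum>x\<in>C. ?f x - (case x of (i, j) \<Rightarrow> the (A i j)))"
    by (rule dvd_sum) (auto split: abs_split)
  then have "even (\<Sum>x\<in>C. ?f x)"
    using zero by (simp add: sum_subtractf)
  moreover have "(\<Sum>x\<in>C. ?f x) = \<Sum>{1..int (n * k)}"
    using heffter_entries[OF assms] sum.reindex[of ?f C id] by (simp add: C_def)
  ultimately have "even (\<Sum>{1..int (n * k)})"
    by (simp only:)
  then have "2 * 2 dvd 2 * \<Sum>{1..int (n * k)}"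
    by (rule mult_dvd_mono[OF dvd_refl])
  also have "2 * \<Sum>{1..int N} = int (N * (N + 1))" for N
  proof (induction N)
    case (Suc N)
    have "{1..int (Suc N)} = insert (int (Suc N)) {1..int N}"
      by auto
    with Suc show ?case
      by (simp add: algebra_simps)
  qed simp
  finally have "int 4 dvd int (n * k * (n * k + 1))"
    by simp
  then show ?thesis
    by (simp only: int_dvd_int_iff)
qed

section \<open>Arrays assembled from signed permutation matrices\<close>

lemma sum_pairs:
  fixes f :: "nat \<Rightarrow> 'a::comm_monoid_add"
  shows "(\<Sum>t<2 * h. f t) = (\<Sum>q<h. f (2 * q) + f (2 * q + 1))"
  by (induction h) (simp_all add: add.assoc)

definition alt_sign :: "nat \<Rightarrow> int" where
  "alt_sign t = (- 1) ^ (t div 2 + t)"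

lemma alt_sign_pair [simp]:
  "alt_sign (2 * q) = (- 1) ^ q" "alt_sign (Suc (2 * q)) = - ((- 1) ^ q)"
  by (simp_all add: alt_sign_def minus_one_power_iff)

lemma alt_sign_cases: "alt_sign t = 1 \<or> alt_sign t = - 1"
  by (simp add: alt_sign_def minus_one_power_iff)

lemma card_alt_sign: "card {t. t < 2 * h \<and> alt_sign t = 1} = card {t. t < 2 * h \<and> alt_sign t = - 1}"
proof -
  have *: "card {t. t < 2 * h \<and> alt_sign t = s} = (\<Sum>t<2 * h. if alt_sign t = s then 1 else 0)" for s
    by (simp add: sum.If_cases lessThan_def Collect_conj_eq)
  show ?thesis
    unfolding * sum_pairs by (rule sum.cong) (auto simp: minus_one_power_iff)
qed

text \<open>Treats rows and columns alike: \<open>p\<close> lists the filled cells of a line and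
  \<open>\<mu>\<close> their absolute values. The two members of each pair \<open>2 * q\<close>,
  \<open>2 * q + 1\<close> have opposite signs, which balances the signs and leaves only an
  alternating sum of pair differences.\<close>

lemma signed_line:
  fixes p :: "nat \<Rightarrow> nat" and f :: "nat \<Rightarrow> int" and \<mu> :: "nat \<Rightarrow> nat"
  assumes inj: "inj_on p {..<2 * h}" and S: "S = p ` {..<2 * h}"
    and f: "\<And>t. t < 2 * h \<Longrightarrow> f (p t) = alt_sign t * int (\<mu> t)"
    and pos: "\<And>t. t < 2 * h \<Longrightarrow> \<mu> t > 0"
    and zero: "(\<Sum>q<h. (- 1) ^ q * (int (\<mu> (2 * q)) - int (\<mu> (2 * q + 1)))) = 0"
  shows "card S = 2 * h" "sum f S = 0" "card {x \<in> S. f x > 0} = card {x \<in> S. f x < 0}"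
proof -
  show "card S = 2 * h"
    using inj by (simp add: S card_image)
  have "sum f S = (\<Sum>t<2 * h. alt_sign t * int (\<mu> t))"
    unfolding S using inj f by (simp add: sum.reindex)
  also have "\<dots> = (\<Sum>q<h. (- 1) ^ q * (int (\<mu> (2 * q)) - int (\<mu> (2 * q + 1))))"
    unfolding sum_pairs by (rule sum.cong) (simp_all add: right_diff_distrib)
  also have "\<dots> = 0"
    by (fact zero)
  finally show "sum f S = 0" .
  have "{x \<in> S. f x > 0} = p ` {t. t < 2 * h \<and> alt_sign t = 1}"
    unfolding S using f pos alt_sign_cases by (force simp: zero_less_mult_iff)
  moreover have "{x \<in> S. f x < 0} = p ` {t. t < 2 * h \<and> alt_sign t = - 1}"
    unfolding S using f pos alt_sign_cases by (force simp: mult_less_0_iff)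
  moreover have "card (p ` {t. t < 2 * h \<and> alt_sign t = s}) = card {t. t < 2 * h \<and> alt_sign t = s}" for s
    by (rule card_image) (use inj in \<open>auto simp: inj_on_def\<close>)
  ultimately show "card {x \<in> S. f x > 0} = card {x \<in> S. f x < 0}"
    by (simp add: card_alt_sign)
qed

text \<open>For fixed \<open>t\<close>, \<open>\<pi>\<close> describes the \<open>t\<close>-th
  permutation matrix from rows to columns and \<open>\<rho>\<close> is its inverse;
  \<open>inj\<close> keeps the matrices disjoint. The entry of matrix \<open>t\<close> in row
  \<open>i\<close> is \<open>\<mu> i t\<close> with sign \<open>alt_sign t\<close>.\<close>

lemma shiftable_heffter_from_permutations:
  fixes \<pi> \<rho> \<mu> :: "nat \<Rightarrow> nat \<Rightarrow> nat"
  assumes \<pi>: "\<And>i t. i < n \<Longrightarrow> t < 2 * h \<Longrightarrow> \<pi> i t < n \<and> \<rho> (\<pi> i t) t = i"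
    and \<rho>: "\<And>j t. j < n \<Longrightarrow> t < 2 * h \<Longrightarrow> \<rho> j t < n \<and> \<pi> (\<rho> j t) t = j"
    and inj: "\<And>i. i < n \<Longrightarrow> inj_on (\<pi> i) {..<2 * h}"
    and pos: "\<And>i t. \<mu> i t > 0"
    and row: "\<And>i. i < n \<Longrightarrow>
      (\<Sum>q<h. (- 1) ^ q * (int (\<mu> i (2 * q)) - int (\<mu> i (2 * q + 1)))) = 0"
    and col: "\<And>j. j < n \<Longrightarrow>
      (\<Sum>q<h. (- 1) ^ q * (int (\<mu> (\<rho> j (2 * q)) (2 * q)) - int (\<mu> (\<rho> j (2 * q + 1)) (2 * q + 1)))) = 0"
    and cover: "\<And>x. 1 \<le> x \<Longrightarrow> x \<le> n * (2 * h) \<Longrightarrow> \<exists>i<n. \<exists>t<2 * h. \<mu> i t = x"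
  shows "\<exists>A. shiftable_heffter_array n (2 * h) A"
proof -
  define w where "w i t = alt_sign t * int (\<mu> i t)" for i t
  \<comment> \<open>By \<open>inj\<close> at most one matrix fills a cell, so \<open>THE\<close>
    recovers its index.\<close>
  define A where "A i j =
    (if \<exists>t<2 * h. \<pi> i t = j then Some (w i (THE t. t < 2 * h \<and> \<pi> i t = j)) else None)" for i j
  have A\<pi>: "A i (\<pi> i t) = Some (w i t)" if "i < n" "t < 2 * h" for i t
  proof -
    have "(THE t'. t' < 2 * h \<and> \<pi> i t' = \<pi> i t) = t"
      using inj[OF that(1)] that by (auto simp: inj_on_def)
    then show ?thesis
      using that by (auto simp: A_def)
  qed
  have A\<rho>: "A (\<rho> j t) j = Some (w (\<rho> j t) t)" if "j < n" "t < 2 * h" for j t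
    using A\<pi>[of "\<rho> j t" t] \<rho>[OF that] that by simp
  have rows: "row_cells n A i = \<pi> i ` {..<2 * h}" if "i < n" for i
    using \<pi>[OF that] by (auto simp: row_cells_def A_def split: if_splits)
  have cols: "col_cells n A j = \<rho> j ` {..<2 * h}" if "j < n" for j
  proof
    show "col_cells n A j \<subseteq> \<rho> j ` {..<2 * h}"
      using \<pi> by (force simp: col_cells_def A_def split: if_splits)
    show "\<rho> j ` {..<2 * h} \<subseteq> col_cells n A j"
      using \<rho> A\<rho> that by (auto simp: col_cells_def)
  qed
  \<comment> \<open>Two matrices meeting column \<open>j\<close> in the same row would share that
    cell, against \<open>inj\<close>.\<close>
  have inj\<rho>: "inj_on (\<rho> j) {..<2 * h}" if "j < n" for j
  proof (rule inj_onI)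
    fix t t' assume t: "t \<in> {..<2 * h}" "t' \<in> {..<2 * h}" "\<rho> j t = \<rho> j t'"
    then have "\<pi> (\<rho> j t) t = \<pi> (\<rho> j t) t'"
      using \<rho>[OF that, of t] \<rho>[OF that, of t'] by simp
    then show "t = t'"
      using inj_onD[OF inj, of "\<rho> j t" t t'] \<rho>[OF that, of t] t(1,2) by simp
  qed
  have row_line: "card (row_cells n A i) = 2 * h" "(\<Sum>j\<in>row_cells n A i. the (A i j)) = 0"
      "card {j \<in> row_cells n A i. the (A i j) > 0} = card {j \<in> row_cells n A i. the (A i j) < 0}"
    if "i < n" for i
    by (rule signed_line[OF inj[OF that] rows[OF that], where \<mu> = "\<mu> i" and f = "\<lambda>j. the (A i j)"];
        use that row pos A\<pi> in \<open>simp add: w_def\<close>)+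
  have col_line: "card (col_cells n A j) = 2 * h" "(\<Sum>i\<in>col_cells n A j. the (A i j)) = 0"
      "card {i \<in> col_cells n A j. the (A i j) > 0} = card {i \<in> col_cells n A j. the (A i j) < 0}"
    if "j < n" for j
    by (rule signed_line[OF inj\<rho>[OF that] cols[OF that],
          where \<mu> = "\<lambda>t. \<mu> (\<rho> j t) t" and f = "\<lambda>i. the (A i j)"];
        use that col pos A\<rho> in \<open>simp add: w_def\<close>)+
  have "\<exists>i<n. \<exists>j<n. A i j = Some x \<or> A i j = Some (- x)" if x: "x \<in> {1..int (n * (2 * h))}" for x
  proof -
    have "1 \<le> nat x" "nat x \<le> n * (2 * h)"
      using x by (auto simp: nat_le_iff)
    then obtain i t where it: "i < n" "t < 2 * h" "\<mu> i t = nat x"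
      using cover by blast
    then have "A i (\<pi> i t) = Some x \<or> A i (\<pi> i t) = Some (- x)"
      using A\<pi>[OF it(1,2)] alt_sign_cases[of t] x by (auto simp: w_def)
    then show ?thesis
      using it \<pi> by blast
  qed
  then have "shiftable_heffter_array n (2 * h) A"
    unfolding shiftable_heffter_array_def heffter_array_def shiftable_def
    using row_line col_line by blast
  then show ?thesis
    by blast
qed

section \<open>Cyclic diagonals for \<open>k\<close> divisible by 4\<close>

lemma cyclic_shift:
  fixes i t n :: nat
  assumes "i < n" "t \<le> n"
  shows "(i + t) mod n < n" "((i + t) mod n + n - t) mod n = i"
    "(i + n - t) mod n < n" "((i + n - t) mod n + t) mod n = i"
proof -
  have "((i + t) mod n + (n - t)) mod n = (i + n) mod n"
    using assms(2) by (subst mod_add_left_eq) simp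
  then show "((i + t) mod n + n - t) mod n = i"
    using assms by simp
  show "((i + n - t) mod n + t) mod n = i"
    using assms by (subst mod_add_left_eq) simp
qed (use assms in simp_all)

lemma cyclic_shift_inj:
  fixes i t t' n :: nat
  assumes "(i + t) mod n = (i + t') mod n" "t < n" "t' < n"
  shows "t = t'"
  using assms cong_add_lcancel_nat[of i t t' n] by (simp add: cong_def)

lemma alternating_sum_even: "(\<Sum>q<2 * s. (- 1) ^ q * (c :: int)) = 0"
  by (induction s) simp_all

lemma shiftable_heffter_diagonals:
  assumes "4 * s \<le> n"
  shows "\<exists>A. shiftable_heffter_array n (2 * (2 * s)) A"
proof -
  define \<pi> where "\<pi> i t = (i + t) mod n" for i t
  define \<rho> where "\<rho> j t = (j + n - t) mod n" for j t
  \<comment> \<open>Diagonal \<open>t\<close> carries the numbers from \<open>t * n + 1\<close> to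
    \<open>t * n + n\<close>. The shift \<open>2 * (t div 2)\<close> is shared by a pair, so the
    pair differences in a fixed row or column do not depend on \<open>q\<close>, and an even number
    of them cancels.\<close>
  define \<mu> where "\<mu> i t = t * n + 1 + (i + 2 * (t div 2)) mod n" for i t
  show ?thesis
  proof (rule shiftable_heffter_from_permutations)
    fix i t assume "i < n" "t < 2 * (2 * s)"
    then show "\<pi> i t < n \<and> \<rho> (\<pi> i t) t = i" "\<rho> i t < n \<and> \<pi> (\<rho> i t) t = i"
      using cyclic_shift[of i n t] assms by (simp_all add: \<pi>_def \<rho>_def)
  next
    fix i show "inj_on (\<pi> i) {..<2 * (2 * s)}"
      using assms by - (rule inj_onI, rule cyclic_shift_inj[of i _ n], auto simp: \<pi>_def)
  next
    fix i t show "\<mu> i t > 0"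
      by (simp add: \<mu>_def)
  next
    fix i
    have "int (\<mu> i (2 * q)) - int (\<mu> i (2 * q + 1)) = - int n" for q
      by (simp add: \<mu>_def algebra_simps)
    then show "(\<Sum>q<2 * s. (- 1) ^ q * (int (\<mu> i (2 * q)) - int (\<mu> i (2 * q + 1)))) = 0"
      by (simp only: alternating_sum_even)
  next
    fix j assume j: "j < n"
    have "int (\<mu> (\<rho> j (2 * q)) (2 * q)) - int (\<mu> (\<rho> j (2 * q + 1)) (2 * q + 1)) =
        int j - int n - int ((j + n - 1) mod n)" if "q < 2 * s" for q
    proof -
      have q: "2 * q + 1 < n"
        using assms that by simp
      have "(\<rho> j (2 * q) + 2 * q) mod n = j"
        using cyclic_shift(4)[of j n "2 * q"] j q by (simp add: \<rho>_def)
      \<comment> \<open>The second diagonal of a pair meets column \<open>j\<close> one row higher,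
        cyclically, but is numbered from the same row; hence the \<open>- 1\<close>.\<close>
      moreover have "(\<rho> j (2 * q + 1) + 2 * q) mod n = (j + n - 1) mod n"
        using q by (simp add: \<rho>_def mod_add_left_eq)
      ultimately show ?thesis
        by (simp add: \<mu>_def algebra_simps)
    qed
    then have "(\<Sum>q<2 * s. (- 1) ^ q *
          (int (\<mu> (\<rho> j (2 * q)) (2 * q)) - int (\<mu> (\<rho> j (2 * q + 1)) (2 * q + 1)))) =
        (\<Sum>q<2 * s. (- 1) ^ q * (int j - int n - int ((j + n - 1) mod n)))"
      by (intro sum.cong) simp_all
    then show "(\<Sum>q<2 * s. (- 1) ^ q *
        (int (\<mu> (\<rho> j (2 * q)) (2 * q)) - int (\<mu> (\<rho> j (2 * q + 1)) (2 * q + 1)))) = 0"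
      by (simp only: alternating_sum_even)
  next
    fix x assume x: "1 \<le> x" "x \<le> n * (2 * (2 * s))"
    define t where "t = (x - 1) div n"
    have t: "t < 2 * (2 * s)"
      unfolding t_def using x by (intro less_mult_imp_div_less) (simp add: mult.commute)
    have n: "n > 0"
      using x by (cases n) auto
    define y where "y = (x - 1) mod n"
    \<comment> \<open>Undoes the cyclic shift in \<open>\<mu>\<close>.\<close>
    define i where "i = (y + n - 2 * (t div 2)) mod n"
    have "(i + 2 * (t div 2)) mod n = y"
      unfolding i_def using cyclic_shift(4)[of y n "2 * (t div 2)"] n t assms by (simp add: y_def)
    moreover have "t * n + 1 + y = x"
      using x by (simp add: t_def y_def)
    ultimately have "\<mu> i t = x"
      by (simp add: \<mu>_def)
    moreover have "i < n"
      using n by (simp add: i_def)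
    ultimately show "\<exists>i<n. \<exists>t<2 * (2 * s). \<mu> i t = x"
      using t by blast
  qed
qed

section \<open>Circulant arrays of 2 by 2 blocks for \<open>k\<close> congruent to 2 modulo
  4\<close>

text \<open>Positions \<open>e\<close>, \<open>4 + e\<close>, \<open>8 + e\<close> with
  \<open>e < 4\<close> hold one Schur triple, its largest member in the middle, so that the signs
  \<open>+ - +\<close> give 0.\<close>

definition schur_entries :: "nat list" where
  "schur_entries = [1, 2, 4, 3, 6, 10, 11, 12, 5, 8, 7, 9]"

definition block_entry :: "nat \<Rightarrow> nat" where
  "block_entry y = (if y < 12 then schur_entries ! y else y + 1)"

lemma schur_entries: "length schur_entries = 12" "set schur_entries = {1..12}"
proof -
  have "{1..12} = set [1..<13 :: nat]"
    by auto
  also have "\<dots> = set schur_entries"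
    by (simp add: schur_entries_def upt_rec numeral_eq_Suc insert_commute)
  finally show "set schur_entries = {1..12}"
    by simp
qed (simp add: schur_entries_def)

lemma block_entry_pos: "block_entry y > 0"
  using nth_mem[of y schur_entries] by (auto simp: block_entry_def schur_entries)

lemma block_entry_surj:
  assumes "1 \<le> x" "x \<le> N" "12 \<le> N"
  shows "\<exists>y<N. block_entry y = x"
proof (cases "x \<le> 12")
  case True
  then have "x \<in> set schur_entries"
    using assms(1) by (simp add: schur_entries)
  then obtain y where "y < 12" "schur_entries ! y = x"
    by (auto simp: in_set_conv_nth schur_entries(1))
  then show ?thesis
    using assms(3) by (intro exI[of _ y]) (simp add: block_entry_def)
next
  case False
  then show ?thesis
    using assms by (intro exI[of _ "x - 1"]) (auto simp: block_entry_def)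
qed

text \<open>The first three blocks cancel by the Schur triples, and each further pair of blocks adds
  4. What matters is that the value does not depend on the position \<open>e\<close> in the
  block.\<close>

lemma block_entry_alternating_sum:
  assumes "e < 4"
  shows "(\<Sum>q<2 * s + 3. (- 1) ^ q * int (block_entry (4 * q + e))) = 4 * int s"
proof (induction s)
  case 0
  have "e \<in> {0, 1, 2, 3}"
    using assms by auto
  then show ?case
    by (auto simp: block_entry_def schur_entries_def numeral_3_eq_3)
next
  case (Suc s)
  have split: "2 * Suc s + 3 = Suc (Suc (2 * s + 3))"
    by simp
  have "block_entry (4 * q + e) = 4 * q + e + 1" if "q \<ge> 3" for q
    using that by (simp add: block_entry_def)
  from this[of "2 * s + 3"] this[of "Suc (2 * s + 3)"] show ?case
    unfolding split sum.lessThan_Suc Suc by simp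
qed

lemma shiftable_heffter_blocks:
  assumes "2 * s + 3 \<le> m"
  shows "\<exists>A. shiftable_heffter_array (2 * m) (2 * (2 * s + 3)) A"
proof -
  text \<open>
    The index \<open>t\<close> selects the block \<open>t div 2\<close> of a block row, and by its parity the main or the other
    diagonal of that block.
  \<close>
  define h where "h = 2 * s + 3"
  define \<pi> where "\<pi> i t = 2 * ((i div 2 + t div 2) mod m) + (i + t) mod 2" for i t
  define \<rho> where "\<rho> j t = 2 * ((j div 2 + m - t div 2) mod m) + (j + t) mod 2" for j t
  \<comment> \<open>Each block row gets \<open>4 * h\<close> consecutive numbers. As
    \<open>(i + t) mod 2\<close> is the parity of the column, the last summand numbers the four
    cells of a block row by row.\<close>
  define \<mu> where "\<mu> i t = 4 * h * (i div 2) + block_entry (4 * (t div 2) + (2 * (i mod 2) + (i + t) mod 2))" for i t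
  have "\<exists>A. shiftable_heffter_array (2 * m) (2 * h) A"
  proof (rule shiftable_heffter_from_permutations)
    fix i t assume it: "i < 2 * m" "t < 2 * h"
    then have i: "i div 2 < m" "t div 2 \<le> m"
      using assms by (auto simp: h_def)
    have lt: "2 * a + (i + t) mod 2 < 2 * m" if "a < m" for a
      using that by presburger
    have div: "(2 * a + (i + t) mod 2) div 2 = a" for a
      by simp
    have mod: "(2 * a + (i + t) mod 2 + t) mod 2 = i mod 2" for a
      by (auto simp: mod2_eq_if)
    show "\<pi> i t < 2 * m \<and> \<rho> (\<pi> i t) t = i" "\<rho> i t < 2 * m \<and> \<pi> (\<rho> i t) t = i"
      unfolding \<pi>_def \<rho>_def unfolding div mod using lt cyclic_shift[OF i] by simp_all
  next
    fix i show "inj_on (\<pi> i) {..<2 * h}"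
    proof (rule inj_onI)
      fix t t' assume t: "t \<in> {..<2 * h}" "t' \<in> {..<2 * h}" and eq: "\<pi> i t = \<pi> i t'"
      have dm: "\<pi> i t div 2 = (i div 2 + t div 2) mod m" "\<pi> i t mod 2 = (i + t) mod 2" for t
        by (simp_all add: \<pi>_def)
      have "(i div 2 + t div 2) mod m = (i div 2 + t' div 2) mod m"
        using arg_cong[OF eq, of "\<lambda>x. x div 2"] by (simp only: dm)
      then have "t div 2 = t' div 2"
      proof (rule cyclic_shift_inj)
        show "t div 2 < m" "t' div 2 < m"
          using t assms by (auto simp: h_def)
      qed
      moreover have "(i + t) mod 2 = (i + t') mod 2"
        using arg_cong[OF eq, of "\<lambda>x. x mod 2"] by (simp only: dm)
      then have "t mod 2 = t' mod 2"
        using cong_add_lcancel_nat[of i t t' 2] unfolding cong_def by blast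
      ultimately show "t = t'"
        by (metis div_mult_mod_eq)
    qed
  next
    fix i t show "\<mu> i t > 0"
      by (simp add: \<mu>_def block_entry_pos)
  next
    fix i
    show "(\<Sum>q<h. (- 1) ^ q * (int (\<mu> i (2 * q)) - int (\<mu> i (2 * q + 1)))) = 0"
    proof -
      \<comment> \<open>The positions of the two cells of row \<open>i\<close> within a block; they
        are the same for every \<open>q\<close>.\<close>
      define e where "e = 2 * (i mod 2) + i mod 2"
      define e' where "e' = 2 * (i mod 2) + (i + 1) mod 2"
      have e: "e < 4" "e' < 4"
        unfolding e_def e'_def by presburger+
      have "(i + 2 * q) mod 2 = i mod 2" "(i + (2 * q + 1)) mod 2 = (i + 1) mod 2" for q
        by presburger+
      then have "(\<Sum>q<h. (- 1) ^ q * (int (\<mu> i (2 * q)) - int (\<mu> i (2 * q + 1)))) =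
          (\<Sum>q<h. (- 1) ^ q * int (block_entry (4 * q + e))) - (\<Sum>q<h. (- 1) ^ q * int (block_entry (4 * q + e')))"
        by (simp add: \<mu>_def e_def e'_def sum_subtractf right_diff_distrib distrib_left)
      then show ?thesis
        using e by (simp add: block_entry_alternating_sum h_def)
    qed
  next
    fix j
    show "(\<Sum>q<h. (- 1) ^ q * (int (\<mu> (\<rho> j (2 * q)) (2 * q)) - int (\<mu> (\<rho> j (2 * q + 1)) (2 * q + 1)))) = 0"
    proof -
      define e where "e = 2 * (j mod 2) + j mod 2"
      define e' where "e' = 2 * ((j + 1) mod 2) + j mod 2"
      have e: "e < 4" "e' < 4"
        unfolding e_def e'_def by presburger+
      have \<rho>_div: "\<rho> j t div 2 = (j div 2 + m - t div 2) mod m"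
        and \<rho>_mod: "\<rho> j t mod 2 = (j + t) mod 2" for t
        by (simp_all add: \<rho>_def)
      have \<rho>_par: "(\<rho> j t + t) mod 2 = j mod 2" for t
        by (auto simp: \<rho>_def mod2_eq_if)
      \<comment> \<open>Both cells of a pair lie in the same block, so the offset of the block row
        cancels in their difference.\<close>
      have "\<mu> (\<rho> j (2 * q)) (2 * q) = 4 * h * ((j div 2 + m - q) mod m) + block_entry (4 * q + e)" for q
        unfolding \<mu>_def \<rho>_div \<rho>_mod \<rho>_par by (simp add: e_def)
      moreover have "\<mu> (\<rho> j (2 * q + 1)) (2 * q + 1) =
          4 * h * ((j div 2 + m - q) mod m) + block_entry (4 * q + e')" for q
      proof -
        have "(j + (2 * q + 1)) mod 2 = (j + 1) mod 2" "(2 * q + 1) div 2 = q"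
          by presburger+
        then show ?thesis
          unfolding \<mu>_def \<rho>_div \<rho>_mod \<rho>_par by (simp only: e'_def)
      qed
      ultimately have "(\<Sum>q<h. (- 1) ^ q * (int (\<mu> (\<rho> j (2 * q)) (2 * q)) - int (\<mu> (\<rho> j (2 * q + 1)) (2 * q + 1)))) =
          (\<Sum>q<h. (- 1) ^ q * int (block_entry (4 * q + e))) - (\<Sum>q<h. (- 1) ^ q * int (block_entry (4 * q + e')))"
        by (simp only: of_nat_add add_diff_cancel_left right_diff_distrib sum_subtractf)
      then show ?thesis
        using e by (simp add: block_entry_alternating_sum h_def)
    qed
  next
    fix x assume x: "1 \<le> x" "x \<le> 2 * m * (2 * h)"
    define i where "i = (x - 1) div (4 * h)"
    have i: "i < m"
      unfolding i_def using x by (intro less_mult_imp_div_less) (simp add: mult.assoc mult.left_commute)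
    have "4 * h > 0"
      by (simp add: h_def)
    then have "(x - 1) mod (4 * h) + 1 \<le> 4 * h"
      using mod_less_divisor[of "4 * h" "x - 1"] by linarith
    then obtain y where y: "y < 4 * h" "block_entry y = (x - 1) mod (4 * h) + 1"
      using block_entry_surj[of "(x - 1) mod (4 * h) + 1" "4 * h"] by (auto simp: h_def)
    \<comment> \<open>The binary digits of \<open>y mod 4\<close> are the row parity
      \<open>a\<close> and the column parity; \<open>t\<close> is chosen so that
      \<open>r + t\<close> has the parity of \<open>y\<close>.\<close>
    define a where "a = y div 2 mod 2"
    define r where "r = 2 * i + a"
    define t where "t = 2 * (y div 4) + (a + y) mod 2"
    have a: "a < 2"
      by (simp add: a_def)
    have "r < 2 * m"
      using i a by (simp add: r_def)
    moreover have "t < 2 * h"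
    proof -
      have "y div 4 < h"
        using y(1) by (intro less_mult_imp_div_less) simp
      moreover have "(a + y) mod 2 < 2"
        by simp
      ultimately show ?thesis
        unfolding t_def by linarith
    qed
    moreover have "\<mu> r t = x"
    proof -
      have r: "r div 2 = i" "r mod 2 = a" and t: "t div 2 = y div 4"
        using a by (simp_all add: r_def t_def)
      have "even (r + t) \<longleftrightarrow> even y"
        by (auto simp: r_def t_def even_iff_mod_2_eq_zero [symmetric])
      then have rt: "(r + t) mod 2 = y mod 2"
        by (simp only: mod2_eq_if)
      have "y div 4 = y div 2 div 2"
        by (simp flip: div_mult2_eq)
      then have cell: "4 * (t div 2) + (2 * (r mod 2) + (r + t) mod 2) = y"
        unfolding r t rt a_def using mult_div_mod_eq[of 2 "y div 2"] mult_div_mod_eq[of 2 y] by linarith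
      have "\<mu> r t = 4 * h * i + ((x - 1) mod (4 * h) + 1)"
        unfolding \<mu>_def r(1) cell y(2) ..
      also have "\<dots> = x"
        using x(1) by (simp add: i_def)
      finally show ?thesis .
    qed
    ultimately show "\<exists>i<2 * m. \<exists>t<2 * h. \<mu> i t = x"
      by blast
  qed
  then show ?thesis
    by (simp add: h_def)
qed

theorem theorem2p5:
  fixes n k :: nat
  assumes "n \<ge> k" and "k \<ge> 3"
  shows "(\<exists>A. shiftable_heffter_array n k A) \<longleftrightarrow> even k \<and> [n * k = 0] (mod 4)"
proof
  assume "\<exists>A. shiftable_heffter_array n k A"
  then obtain A where A: "shiftable_heffter_array n k A" ..
  then have k: "even k"
    using assms by (intro shiftable_heffter_even) auto
  have "4 dvd n * k * (n * k + 1)"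
    using A by (intro heffter_even_sum) (auto simp: shiftable_heffter_array_def)
  moreover have "coprime 4 (n * k + 1)"
    using k coprime_power_left_iff[of 2 2 "n * k + 1"] by simp
  ultimately have "4 dvd n * k"
    by (simp only: coprime_dvd_mult_left_iff)
  with k show "even k \<and> [n * k = 0] (mod 4)"
    by (simp add: cong_0_iff)
next
  assume *: "even k \<and> [n * k = 0] (mod 4)"
  show "\<exists>A. shiftable_heffter_array n k A"
  proof (cases "4 dvd k")
    case True
    then obtain s where "k = 2 * (2 * s)"
      by auto
    then show ?thesis
      using shiftable_heffter_diagonals[of s n] assms(1) by simp
  next
    case False
    with * obtain c where c: "k = 2 * c" "odd c"
      by (auto elim!: evenE)
    \<comment> \<open>The bound \<open>k \<ge> 3\<close> excludes \<open>c = 1\<close>, so the odd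
      number \<open>c\<close> is at least 3.\<close>
    then obtain s where s: "k = 2 * (2 * s + 3)"
      using assms(2) by (intro that[of "(c - 3) div 2"]) presburger
    have "even n"
      using * c by (auto simp: cong_0_iff mult.left_commute[of n 2])
    then obtain m where "n = 2 * m" ..
    then show ?thesis
      using shiftable_heffter_blocks[of s m] s assms(1) by simp
  qed
qed

end
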